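(* Let $\Gamma$ be a connected cubic vertex-transitive graph. Then the following are equivalent: (1) there exists a strong clique in $\Gamma$; (2) $\Gamma$ is localizable; (3) $\Gamma$ is isomorphic to one of $K_4$, $K_{3,3}$, or $\overline{C_6}$.
   Context: All graphs are finite and simple; cubic means 3-regular. A clique is strong if it intersects every inclusion-maximal independent set. A graph is localizable if its vertex set can be partitioned into strong cliques. $\overline{C_6}$ is the complement of the 6-cycle. A graph is vertex-transitive if its automorphism group acts transitively on its vertices. *)

theory Defs
  imports
    "Graph_Theory.Graph_Theory"
    "HOL-Library.Disjoint_Sets"
begin

text \<open>
  Finite simple graphs are elements of \<^typ>\<open>'a pair_pre_digraph\<close> satisfying
  \<^const>\<open>pair_graph\<close>: a finite vertex set with a symmetric, irreflexive arc
  relation. The edge \<open>uv\<close> is the pair of arcs \<open>(u,v)\<close> and \<open>(v,u)\<close>, so the degree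
  of a vertex is its \<^const>\<open>out_degree\<close>.
\<close>

definition cubic :: "'a pair_pre_digraph \<Rightarrow> bool" where
  "cubic G \<longleftrightarrow> (\<forall>v \<in> pverts G. out_degree (with_proj G) v = 3)"

text \<open>
  A \<^typ>\<open>('a,'b,'c,'d) digraph_isomorphism\<close> carries the target's head and tail maps,
  so \<^term>\<open>app_iso h G = G\<close> makes \<open>h\<close> an automorphism of \<open>G\<close>.
\<close>

definition graph_automorphism ::
    "'a pair_pre_digraph \<Rightarrow> ('a, 'a \<times> 'a, 'a, 'a \<times> 'a) digraph_isomorphism \<Rightarrow> bool" where
  "graph_automorphism G h \<longleftrightarrow>
     pre_digraph.digraph_isomorphism (with_proj G) h \<and> app_iso h (with_proj G) = with_proj G"

definition vertex_transitive :: "'a pair_pre_digraph \<Rightarrow> bool" where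
  "vertex_transitive G \<longleftrightarrow>
     (\<forall>u \<in> pverts G. \<forall>v \<in> pverts G. \<exists>h. graph_automorphism G h \<and> iso_verts h u = v)"

definition clique :: "'a pair_pre_digraph \<Rightarrow> 'a set \<Rightarrow> bool" where
  "clique G C \<longleftrightarrow> C \<subseteq> pverts G \<and> (\<forall>u \<in> C. \<forall>v \<in> C. u \<noteq> v \<longrightarrow> (u, v) \<in> parcs G)"

definition independent_set :: "'a pair_pre_digraph \<Rightarrow> 'a set \<Rightarrow> bool" where
  "independent_set G I \<longleftrightarrow> I \<subseteq> pverts G \<and> (\<forall>u \<in> I. \<forall>v \<in> I. (u, v) \<notin> parcs G)"

definition maximal_independent_set :: "'a pair_pre_digraph \<Rightarrow> 'a set \<Rightarrow> bool" where
  "maximal_independent_set G I \<longleftrightarrow>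
     independent_set G I \<and> (\<forall>J. independent_set G J \<and> I \<subseteq> J \<longrightarrow> J = I)"

definition strong_clique :: "'a pair_pre_digraph \<Rightarrow> 'a set \<Rightarrow> bool" where
  "strong_clique G C \<longleftrightarrow>
     clique G C \<and> (\<forall>I. maximal_independent_set G I \<longrightarrow> C \<inter> I \<noteq> {})"

definition localizable :: "'a pair_pre_digraph \<Rightarrow> bool" where
  "localizable G \<longleftrightarrow> (\<exists>P. partition_on (pverts G) P \<and> (\<forall>C \<in> P. strong_clique G C))"

definition complement_graph :: "'a pair_pre_digraph \<Rightarrow> 'a pair_pre_digraph" where
  "complement_graph G =
     \<lparr> pverts = pverts G,
       parcs = {(u, v). u \<in> pverts G \<and> v \<in> pverts G \<and> u \<noteq> v \<and> (u, v) \<notin> parcs G} \<rparr>"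

text \<open>The cycle on vertices \<open>0, \<dots>, n - 1\<close>; a cycle only for \<open>n \<ge> 3\<close>.\<close>

definition cycle_graph :: "nat \<Rightarrow> nat pair_pre_digraph" where
  "cycle_graph n =
     \<lparr> pverts = {..<n},
       parcs = {(i, j). i < n \<and> j < n \<and> (j = (i + 1) mod n \<or> i = (j + 1) mod n)} \<rparr>"

end

theory Submission
  imports Defs
begin

text \<open>
  Every independent set extends to a maximal one, so a clique is strong iff no independent set
  disjoint from it dominates it. A strong clique is therefore not empty and not a single vertex;
  a strong edge forces all edges between the two remaining neighbourhoods of its ends, hence
  \<open>K\<^bsub>3,3\<^esub>\<close>; four vertices give \<open>K\<^bsub>4\<^esub>\<close>. For a strong triangle
  \<open>uvw\<close> two of the outer neighbours are adjacent, say \<open>x \<sim> y\<close>. By transitivity every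
  vertex lies on a triangle and on a 4-cycle: the former excludes that the third outer neighbour
  is \<open>x\<close> or \<open>y\<close> and puts \<open>xy\<close> on a triangle \<open>xyt\<close>, and the latter, applied to \<open>w\<close>,
  gives \<open>w \<sim> t\<close>, the triangular prism.
\<close>

section \<open>Isomorphisms\<close>

text \<open>In a pair graph the ends of an arc are the arc itself, so the arc map and the head and
  tail maps of an isomorphism are forced by the vertex map. The bijection runs from \<open>H\<close>
  to \<open>G\<close> so that a concrete \<open>H\<close> can label the vertices of an unknown
  \<open>G\<close>.\<close>

lemma digraph_iso_with_proj_iff:
  assumes "pair_wf_digraph G" "pair_wf_digraph H"
  shows "digraph_iso (with_proj G) (with_proj H) \<longleftrightarrow>
    (\<exists>g. bij_betw g (pverts H) (pverts G) \<and>
      (\<forall>i\<in>pverts H. \<forall>j\<in>pverts H. (i, j) \<in> parcs H \<longleftrightarrow> (g i, g j) \<in> parcs G))"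
    (is "?L \<longleftrightarrow> ?R")
proof
  interpret G: pair_wf_digraph G by fact
  interpret H: pair_wf_digraph H by fact
  assume ?L
  then obtain f where iso: "pre_digraph.digraph_isomorphism (with_proj G) f"
    and H: "with_proj H = app_iso f (with_proj G)"
    by (auto simp: digraph_iso_def)
  from arg_cong[OF H, of verts] arg_cong[OF H, of arcs_ends] iso
  have V: "pverts H = iso_verts f ` pverts G"
    and E: "parcs H = map_prod (iso_verts f) (iso_verts f) ` parcs G"
    by (simp_all add: G.arcs_ends_app_iso_eq map_prod_def)
  have inj: "inj_on (iso_verts f) (pverts G)"
    using iso by (simp add: G.digraph_isomorphism_def)
  have "(i, j) \<in> parcs H \<longleftrightarrow>
      (inv_into (pverts G) (iso_verts f) i, inv_into (pverts G) (iso_verts f) j) \<in> parcs G"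
    if "i \<in> pverts H" "j \<in> pverts H" for i j
    using that inj unfolding V E
    by (auto simp: inv_into_f_f G.in_arcsD1 G.in_arcsD2)
  then show ?R
    using bij_betw_inv_into[of "iso_verts f" "pverts G" "pverts H"] inj V
    by (auto simp: bij_betw_def intro!: exI[of _ "inv_into (pverts G) (iso_verts f)"])
next
  interpret G: pair_wf_digraph G by fact
  interpret H: pair_wf_digraph H by fact
  assume ?R
  then obtain g where bij: "bij_betw g (pverts H) (pverts G)"
    and E: "\<forall>i\<in>pverts H. \<forall>j\<in>pverts H. (i, j) \<in> parcs H \<longleftrightarrow> (g i, g j) \<in> parcs G"
    by auto
  define f where "f = inv_into (pverts H) g"
  have f: "bij_betw f (pverts G) (pverts H)"
    unfolding f_def using bij by (rule bij_betw_inv_into)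
  have gf: "g (f v) = v" if "v \<in> pverts G" for v
    using bij that unfolding f_def by (simp add: bij_betw_inv_into_right)
  have fg: "f (g v) = v" if "v \<in> pverts H" for v
    using bij that unfolding f_def by (simp add: bij_betw_inv_into_left)
  have fV: "f v \<in> pverts H" if "v \<in> pverts G" for v
    using f that by (auto simp: bij_betw_def)
  have arcs: "parcs H = map_prod f f ` parcs G"
  proof (intro set_eqI iffI)
    fix e assume e: "e \<in> parcs H"
    obtain i j where ij: "e = (i, j)" by force
    with e have "i \<in> pverts H" "j \<in> pverts H" by (auto simp: H.in_arcsD1 H.in_arcsD2)
    with e ij E have "(g i, g j) \<in> parcs G" "e = map_prod f f (g i, g j)" by (auto simp: fg)
    then show "e \<in> map_prod f f ` parcs G" by (rule rev_image_eqI)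
  next
    fix e assume "e \<in> map_prod f f ` parcs G"
    then obtain u v where "(u, v) \<in> parcs G" "e = (f u, f v)" by auto
    moreover then have "u \<in> pverts G" "v \<in> pverts G" by (auto simp: G.in_arcsD1 G.in_arcsD2)
    ultimately show "e \<in> parcs H" using E by (auto simp: fV gf)
  qed
  \<comment> \<open>The target's head and tail have to be \<open>snd\<close> and \<open>fst\<close>,
    since these are the ones that \<open>with_proj H\<close> has.\<close>
  define h where "h = \<lparr>iso_verts = f, iso_arcs = map_prod f f, iso_head = snd, iso_tail = fst\<rparr>"
  have "inj_on f (pverts G)" using f by (simp add: bij_betw_def)
  then have "inj_on (map_prod f f) (parcs G)"
    by (auto simp: inj_on_def G.in_arcsD1 G.in_arcsD2)
  then have "pre_digraph.digraph_isomorphism (with_proj G) h"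
    using \<open>inj_on f (pverts G)\<close> by (simp add: G.digraph_isomorphism_def h_def G.wf_digraph)
  moreover have "with_proj H = app_iso h (with_proj G)"
    using f arcs by (simp add: app_iso_def h_def with_proj_def bij_betw_def)
  ultimately show ?L by (auto simp: digraph_iso_def)
qed

lemma graph_automorphism_inj_on:
  "graph_automorphism G h \<Longrightarrow> inj_on (iso_verts h) (pverts G)"
  by (simp add: graph_automorphism_def pre_digraph.digraph_isomorphism_def)

lemma graph_automorphism_arc:
  assumes "graph_automorphism G h" "(u, v) \<in> parcs G"
  shows "(iso_verts h u, iso_verts h v) \<in> parcs G"
proof -
  have iso: "pre_digraph.digraph_isomorphism (with_proj G) h"
    and app: "app_iso h (with_proj G) = with_proj G"
    using assms(1) by (auto simp: graph_automorphism_def)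
  then have "wf_digraph (with_proj G)"
    by (simp add: pre_digraph.digraph_isomorphism_def)
  from wf_digraph.arcs_ends_app_iso_eq[OF this iso] assms(2) show ?thesis
    unfolding app by force
qed

section \<open>The complement of the 6-cycle as an explicit list of arcs\<close>

abbreviation c6_compl :: "nat pair_pre_digraph" where
  "c6_compl \<equiv> complement_graph (cycle_graph 6)"

lemma pverts_c6_compl: "pverts c6_compl = {0, 1, 2, 3, 4, 5}"
  by (auto simp: complement_graph_def cycle_graph_def)

text \<open>The 36 pairs of vertices are decided one by one; outside the square of the vertex set
  neither side has an element. The explicit list lets later case distinctions be settled by
  simplification.\<close>

lemma parcs_c6_compl:
  "parcs c6_compl =
    {(0, 2), (0, 3), (0, 4), (1, 3), (1, 4), (1, 5), (2, 0), (2, 4), (2, 5),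
     (3, 0), (3, 1), (3, 5), (4, 0), (4, 1), (4, 2), (5, 1), (5, 2), (5, 3)}" (is "_ = ?E")
proof -
  have agree: "(i, j) \<in> parcs c6_compl \<longleftrightarrow> (i, j) \<in> ?E"
    if "i \<in> {0, 1, 2, 3, 4, 5}" "j \<in> {0, 1, 2, 3, 4, 5}" for i j
    using that by (elim insertE emptyE) (simp_all add: complement_graph_def cycle_graph_def)
  let ?V = "{0, 1, 2, 3, 4, 5} :: nat set"
  have sub: "parcs c6_compl \<subseteq> ?V \<times> ?V" "?E \<subseteq> ?V \<times> ?V"
    unfolding pverts_c6_compl[symmetric] by (auto simp: complement_graph_def cycle_graph_def)
  show ?thesis
  proof (rule set_eqI)
    fix e
    show "e \<in> parcs c6_compl \<longleftrightarrow> e \<in> ?E"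
    proof (cases "e \<in> ?V \<times> ?V")
      case True
      then have "fst e \<in> ?V" "snd e \<in> ?V" by (simp_all only: mem_Times_iff)
      from agree[OF this] show ?thesis by (simp only: prod.collapse)
    next
      case False
      from contra_subsetD[OF sub(1) this] contra_subsetD[OF sub(2) this] show ?thesis
        by (simp only:)
    qed
  qed
qed

lemma pair_wf_digraph_c6_compl: "pair_wf_digraph c6_compl"
  by unfold_locales (auto simp: complement_graph_def)

section \<open>Strong cliques and neighbourhoods\<close>

context pair_graph
begin

text \<open>Connectedness speaks of the symmetric closure, which has the same arcs here, so every
  vertex is reached from \<open>s\<close> and induction along the path stays in \<open>S\<close>.
  This fixes the vertex set once all neighbours of the named vertices are known.\<close>

lemma connected_closed_eq:
  assumes conn: "connected (with_proj G)" and S: "S \<subseteq> pverts G" "s \<in> S"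
    and closed: "\<And>u v. u \<in> S \<Longrightarrow> (u, v) \<in> parcs G \<Longrightarrow> v \<in> S"
  shows "S = pverts G"
proof
  have sym: "parcs (mk_symmetric (with_proj G)) = parcs G"
    by (auto simp: mk_symmetric_def arcs_symmetric)
  have V: "pverts (mk_symmetric (with_proj G)) = pverts G"
    by (simp add: mk_symmetric_def)
  show "pverts G \<subseteq> S"
  proof
    fix v assume "v \<in> pverts G"
    with conn S have "s \<rightarrow>\<^sup>*\<^bsub>with_proj (mk_symmetric (with_proj G))\<^esub> v"
      by (auto simp: connected_def strongly_connected_def V)
    then have "(s, v) \<in> (parcs G)\<^sup>*" by (auto dest!: reachable_rtranclI simp: sym)
    then show "v \<in> S" by induction (use S closed in auto)
  qed
qed (rule S)

lemma maximal_independent_set_extends: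
  assumes "independent_set G I"
  obtains J where "maximal_independent_set G J" "I \<subseteq> J"
proof -
  have "finite {J. independent_set G J}"
    by (rule finite_subset[of _ "Pow (pverts G)"]) (auto simp: independent_set_def pair_finite_verts)
  from finite_has_maximal2[OF this, of I] assms obtain J
    where "independent_set G J" "I \<subseteq> J" "\<forall>K. independent_set G K \<longrightarrow> J \<subseteq> K \<longrightarrow> J = K"
    by auto
  with that[of J] show ?thesis by (auto simp: maximal_independent_set_def)
qed

text \<open>If an independent \<open>I\<close> dominates \<open>C\<close>, no maximal independent
  set containing \<open>I\<close> can meet \<open>C\<close>. Conversely, a maximal independent set
  that misses \<open>C\<close> dominates \<open>C\<close> itself, by maximality.\<close>

lemma strong_clique_iff:
  "strong_clique G C \<longleftrightarrow> clique G C \<and>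
    (\<forall>I. independent_set G I \<and> I \<inter> C = {} \<longrightarrow> \<not> (\<forall>v\<in>C. \<exists>w\<in>I. (v, w) \<in> parcs G))"
proof (intro iffI conjI allI impI notI)
  assume strong: "strong_clique G C"
  then show "clique G C" by (simp add: strong_clique_def)
  fix I assume I: "independent_set G I \<and> I \<inter> C = {}"
    and dom: "\<forall>v\<in>C. \<exists>w\<in>I. (v, w) \<in> parcs G"
  then obtain J where J: "maximal_independent_set G J" "I \<subseteq> J"
    using maximal_independent_set_extends by blast
  with strong obtain v where v: "v \<in> C" "v \<in> J" by (auto simp: strong_clique_def)
  with dom obtain w where "w \<in> I" "(v, w) \<in> parcs G" by blast
  moreover have "independent_set G J" using J by (simp add: maximal_independent_set_def)
  ultimately show False using J(2) v(2) unfolding independent_set_def by blast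
next
  assume R: "clique G C \<and>
    (\<forall>I. independent_set G I \<and> I \<inter> C = {} \<longrightarrow> \<not> (\<forall>v\<in>C. \<exists>w\<in>I. (v, w) \<in> parcs G))"
  show "strong_clique G C" unfolding strong_clique_def
  proof (intro conjI allI impI)
    fix I assume max: "maximal_independent_set G I"
    then have I: "independent_set G I" by (simp add: maximal_independent_set_def)
    show "C \<inter> I \<noteq> {}"
    proof
      assume disj: "C \<inter> I = {}"
      have "\<exists>w\<in>I. (v, w) \<in> parcs G" if v: "v \<in> C" for v
      proof (rule ccontr)
        assume "\<not> ?thesis"
        \<comment> \<open>A vertex \<open>v\<close> without a neighbour in \<open>I\<close> could be
          added to \<open>I\<close>.\<close>
        then have "(v, w) \<notin> parcs G \<and> (w, v) \<notin> parcs G" if "w \<in> insert v I" for w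
          using that arcs_symmetric no_loops' by blast
        moreover have "v \<in> pverts G" using v R by (auto simp: clique_def)
        ultimately have "independent_set G (insert v I)"
          using I by (simp add: independent_set_def)
        with max have "v \<in> I" unfolding maximal_independent_set_def by blast
        with v disj show False by auto
      qed
      with R I disj show False by blast
    qed
  qed (use R in simp)
qed

section \<open>Neighbourhoods in a cubic graph\<close>

lemma cubic_card_neighbours:
  assumes "cubic G" "v \<in> pverts G"
  shows "card {w. (v, w) \<in> parcs G} = 3"
proof -
  have "out_arcs (with_proj G) v = Pair v ` {w. (v, w) \<in> parcs G}" by (auto simp: out_arcs_def)
  then have "out_degree (with_proj G) v = card {w. (v, w) \<in> parcs G}"
    by (simp add: out_degree_def card_image inj_on_def)
  with assms show ?thesis by (simp add: cubic_def)
qed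

lemma finite_neighbours: "finite {w. (v, w) \<in> parcs G}"
  by (rule finite_subset[OF _ pair_finite_verts]) (auto simp: in_arcsD2)

text \<open>Names the remaining element of a three-element neighbourhood. The equivalence describes
  adjacency at \<open>v\<close> completely and serves as a rewrite rule in the structural
  arguments.\<close>

lemma cubic_third_neighbour:
  assumes "cubic G" "(v, a) \<in> parcs G" "(v, b) \<in> parcs G" "a \<noteq> b"
  obtains c where "c \<noteq> a" "c \<noteq> b" "\<And>w. (v, w) \<in> parcs G \<longleftrightarrow> w = a \<or> w = b \<or> w = c"
proof -
  have "card {w. (v, w) \<in> parcs G} = 3"
    using assms(1) in_arcsD1[OF assms(2)] by (rule cubic_card_neighbours)
  then obtain x y z where "{w. (v, w) \<in> parcs G} = {x, y, z}" "x \<noteq> y" "y \<noteq> z" "x \<noteq> z"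
    by (auto simp: card_3_iff)
  with assms(2-4) that[of x] that[of y] that[of z] show ?thesis by (auto simp: set_eq_iff)
qed

lemma cubic_other_neighbours:
  assumes "cubic G" "(v, a) \<in> parcs G"
  obtains b c where "b \<noteq> a" "c \<noteq> a" "b \<noteq> c" "\<And>w. (v, w) \<in> parcs G \<longleftrightarrow> w = a \<or> w = b \<or> w = c"
proof -
  have "card {w. (v, w) \<in> parcs G} = 3"
    using assms(1) in_arcsD1[OF assms(2)] by (rule cubic_card_neighbours)
  then obtain x y z where "{w. (v, w) \<in> parcs G} = {x, y, z}" "x \<noteq> y" "y \<noteq> z" "x \<noteq> z"
    by (auto simp: card_3_iff)
  with assms(2) that[of x y] that[of x z] that[of y z] show ?thesis by (auto simp: set_eq_iff)
qed

lemma cubic_neighbours: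
  assumes "cubic G" "(v, a) \<in> parcs G" "(v, b) \<in> parcs G" "(v, c) \<in> parcs G"
    and "a \<noteq> b" "a \<noteq> c" "b \<noteq> c"
  shows "(v, w) \<in> parcs G \<longleftrightarrow> w = a \<or> w = b \<or> w = c"
  using cubic_third_neighbour[OF assms(1-3,5)] assms(4,6,7) by metis

text \<open>A clique lies in the closed neighbourhood of any of its vertices, which has four
  elements. Sizes 0 and 1 fail because such cliques are dominated by an independent set.\<close>

lemma strong_clique_card:
  assumes "cubic G" "pverts G \<noteq> {}" "strong_clique G C"
  shows "card C \<in> {2, 3, 4}"
proof -
  have C: "C \<subseteq> pverts G" "clique G C" using assms(3) by (auto simp: strong_clique_def clique_def)
  have fin: "finite C" using C(1) pair_finite_verts by (rule finite_subset)
  \<comment> \<open>The empty clique is dominated vacuously by \<open>I = {}\<close>.\<close>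
  have "C \<noteq> {}"
    using assms(3) by (auto simp: strong_clique_iff independent_set_def)
  then obtain u where u: "u \<in> C" by auto
  have card: "card {w. (u, w) \<in> parcs G} = 3"
    using assms(1) u C(1) by (auto intro: cubic_card_neighbours)
  have "C \<subseteq> insert u {w. (u, w) \<in> parcs G}"
    using C(2) u by (auto simp: clique_def)
  then have "card C \<le> card (insert u {w. (u, w) \<in> parcs G})"
    by (intro card_mono finite.insertI finite_neighbours)
  also have "\<dots> \<le> 4" using card_insert_le_m1[of 4 "{w. (u, w) \<in> parcs G}" u] card by simp
  finally have "card C \<le> 4" .
  moreover have "card C \<noteq> 1"
  proof
    assume "card C = 1"
    with u have Cu: "C = {u}" by (auto simp: card_1_singleton_iff)
    from card have "{w. (u, w) \<in> parcs G} \<noteq> {}" by (metis card.empty zero_neq_numeral)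
    then obtain w where w: "(u, w) \<in> parcs G" by blast
    then have "independent_set G {w}" "{w} \<inter> C = {}"
      using Cu no_loops' by (auto simp: independent_set_def in_arcsD2)
    with w Cu assms(3) show False by (auto simp: strong_clique_iff)
  qed
  moreover have "card C \<noteq> 0" using fin u by auto
  ultimately show ?thesis by auto
qed

section \<open>Strong cliques with four and with two vertices\<close>

text \<open>Each vertex of \<open>C\<close> has all its three neighbours inside \<open>C\<close>, so
  \<open>C\<close> is closed under adjacency and connectedness makes it the whole graph.\<close>

lemma complete_if_clique_card_4:
  assumes "connected (with_proj G)" "cubic G" "clique G C" "card C = 4"
  shows "K\<^bsub>4\<^esub> (with_proj G)"
proof -
  have C: "C \<subseteq> pverts G" "\<And>u v. u \<in> C \<Longrightarrow> v \<in> C \<Longrightarrow> u \<noteq> v \<Longrightarrow> (u, v) \<in> parcs G"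
    using assms(3) by (auto simp: clique_def)
  have fin: "finite C" using C(1) pair_finite_verts by (rule finite_subset)
  have nbrs: "{v. (u, v) \<in> parcs G} = C - {u}" if "u \<in> C" for u
  proof (rule sym, rule card_subset_eq[OF finite_neighbours])
    show "C - {u} \<subseteq> {v. (u, v) \<in> parcs G}" using C that by auto
    show "card (C - {u}) = card {v. (u, v) \<in> parcs G}"
      using that C assms(2,4) fin by (subst cubic_card_neighbours) auto
  qed
  obtain s where "s \<in> C" using assms(4) by fastforce
  with assms(1) C(1) have "C = pverts G" by (rule connected_closed_eq) (use nbrs in auto)
  with assms(4) nbrs show ?thesis
    by (auto simp: complete_digraph_pair_def pair_finite_verts in_arcsD1 in_arcsD2 dest: no_loops')
qed

text \<open>The four edges forced between \<open>{a, b}\<close> and \<open>{c, d}\<close> give each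
  of the six vertices three known neighbours; these six are then closed under adjacency.\<close>

lemma complete_bipartite_if_strong_edge:
  assumes conn: "connected (with_proj G)" and cubic: "cubic G"
    and strong: "strong_clique G {u, v}" and uv: "u \<noteq> v"
  shows "K\<^bsub>3,3\<^esub> (with_proj G)"
proof -
  have adj: "(u, v) \<in> parcs G" "(v, u) \<in> parcs G"
    using strong uv by (auto simp: strong_clique_def clique_def)
  obtain a b where ab: "a \<noteq> v" "b \<noteq> v" "a \<noteq> b"
    and u: "\<And>w. (u, w) \<in> parcs G \<longleftrightarrow> w = v \<or> w = a \<or> w = b"
    using cubic_other_neighbours[OF cubic adj(1)] by blast
  obtain c d where cd: "c \<noteq> u" "d \<noteq> u" "c \<noteq> d"
    and v: "\<And>w. (v, w) \<in> parcs G \<longleftrightarrow> w = u \<or> w = c \<or> w = d"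
    using cubic_other_neighbours[OF cubic adj(2)] by blast
  have loop: "(x, x) \<notin> parcs G" for x using no_loops' by blast
  have sym: "(x, y) \<in> parcs G \<longleftrightarrow> (y, x) \<in> parcs G" for x y using arcs_symmetric by blast
  have xu: "x \<noteq> u" if "x \<in> {a, b}" for x using u that loop by blast
  have yv: "y \<noteq> v" if "y \<in> {c, d}" for y using v that loop by blast
  \<comment> \<open>Otherwise \<open>{x, y}\<close> is an independent set dominating the edge
    \<open>uv\<close>.\<close>
  have edge: "(x, y) \<in> parcs G" if x: "x \<in> {a, b}" and y: "y \<in> {c, d}" for x y
  proof (rule ccontr)
    assume n: "(x, y) \<notin> parcs G"
    have "(u, x) \<in> parcs G" "(v, y) \<in> parcs G" using x y u v by auto
    moreover from this n have "independent_set G {x, y}"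
      using loop arcs_symmetric by (auto simp: independent_set_def intro: in_arcsD2)
    moreover have "{x, y} \<inter> {u, v} = {}" using x y ab cd xu yv by auto
    ultimately show False using strong unfolding strong_clique_iff by blast
  qed
  have disj: "x \<noteq> y" if "x \<in> {a, b}" "y \<in> {c, d}" for x y using edge[OF that] loop by blast
  have x: "(x, w) \<in> parcs G \<longleftrightarrow> w = u \<or> w = c \<or> w = d" if "x \<in> {a, b}" for x w
    using cubic edge[OF that] u that cd sym by (intro cubic_neighbours) auto
  have y: "(y, w) \<in> parcs G \<longleftrightarrow> w = v \<or> w = a \<or> w = b" if "y \<in> {c, d}" for y w
    using cubic edge[OF _ that] v that ab sym by (intro cubic_neighbours) auto
  have "{u, c, d} \<union> {v, a, b} = pverts G"
  proof (rule connected_closed_eq[OF conn])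
    show "{u, c, d} \<union> {v, a, b} \<subseteq> pverts G" using u v by (auto intro: in_arcsD2)
    show "u \<in> {u, c, d} \<union> {v, a, b}" by simp
  qed (use u v x y in blast)
  then have V: "pverts G = {u, c, d} \<union> {v, a, b}" by simp
  \<comment> \<open>The reversed list provides every inequality in the other orientation for the
    simplifier.\<close>
  have dist: "distinct [u, c, d, v, a, b]" "distinct [b, a, v, d, c, u]"
    using uv xu[of a] xu[of b] yv[of c] yv[of d] disj[of a c] disj[of a d] disj[of b c] disj[of b d]
      ab cd by auto
  then have "{u, c, d} \<inter> {v, a, b} = {}" by auto
  moreover have "parcs G = {u, c, d} \<times> {v, a, b} \<union> {v, a, b} \<times> {u, c, d}" (is "_ = ?E")
  proof -
    have "(p, q) \<in> parcs G \<longleftrightarrow> (p, q) \<in> ?E" for p q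
    proof (cases "p \<in> pverts G")
      case True
      then consider "p = u" | "p = c" | "p = d" | "p = v" | "p = a" | "p = b"
        unfolding V by blast
      then show ?thesis by cases (use dist in \<open>simp_all add: u v x y\<close>)
    qed (use V in \<open>auto dest: in_arcsD1\<close>)
    then show ?thesis by (intro set_eqI) (simp only: split_paired_all)
  qed
  moreover have "card {u, c, d} = 3" "card {v, a, b} = 3" using ab cd by auto
  ultimately show ?thesis unfolding complete_bipartite_digraph_pair_def
    using pair_finite_verts V by blast
qed

section \<open>The triangular prism\<close>

text \<open>Strength of the triangle is represented by the single edge \<open>adj\<close> between
  outer neighbours; the cases with another pair of outer neighbours follow by renaming. Transitivity
  spreads the triangle \<open>u v w\<close> and the 4-cycle \<open>u v v' u'\<close> to all
  vertices, which determines the graph.\<close>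

lemma c6_compl_iso_if_strong_triangle_aux:
  assumes conn: "connected (with_proj G)" and cubic: "cubic G" and trans: "vertex_transitive G"
    and u: "\<And>z. (u, z) \<in> parcs G \<longleftrightarrow> z = v \<or> z = w \<or> z = u'"
    and v: "\<And>z. (v, z) \<in> parcs G \<longleftrightarrow> z = u \<or> z = w \<or> z = v'"
    and w: "\<And>z. (w, z) \<in> parcs G \<longleftrightarrow> z = u \<or> z = v \<or> z = w'"
    and outer: "u' \<noteq> v" "u' \<noteq> w" "v' \<noteq> u" "v' \<noteq> w" "w' \<noteq> u" "w' \<noteq> v"
    and adj: "(u', v') \<in> parcs G"
  shows "digraph_iso (with_proj G) (with_proj c6_compl)"
proof -
  have loop: "(x, x) \<notin> parcs G" for x using no_loops' by blast
  have sym: "(x, y) \<in> parcs G \<longleftrightarrow> (y, x) \<in> parcs G" for x y using arcs_symmetric by blast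
  have inV: "u \<in> pverts G" using u by (auto intro: in_arcsD1)
  have uvw: "u \<noteq> v" "u \<noteq> w" "v \<noteq> w" "u' \<noteq> u" "v' \<noteq> v" "w' \<noteq> w" "u' \<noteq> v'"
    using u v w adj loop by metis+
  have move: "\<exists>f. inj_on f (pverts G) \<and> f u = x \<and> (\<forall>y z. (y, z) \<in> parcs G \<longrightarrow> (f y, f z) \<in> parcs G)"
    if x: "x \<in> pverts G" for x
  proof -
    obtain h where "graph_automorphism G h" "iso_verts h u = x"
      using trans inV x unfolding vertex_transitive_def by blast
    then show ?thesis
      by (blast intro: graph_automorphism_inj_on graph_automorphism_arc)
  qed
  have triangle: "\<exists>y z. (x, y) \<in> parcs G \<and> (y, z) \<in> parcs G \<and> (x, z) \<in> parcs G"
    if x: "x \<in> pverts G" for x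
    using move[OF x] u v by metis
  have square: "\<exists>p q r. (x, p) \<in> parcs G \<and> (p, q) \<in> parcs G \<and> (q, r) \<in> parcs G \<and>
      (x, r) \<in> parcs G \<and> x \<noteq> q \<and> p \<noteq> r" if x: "x \<in> pverts G" for x
  proof -
    obtain f where f: "inj_on f (pverts G)" "f u = x"
      "\<And>y z. (y, z) \<in> parcs G \<Longrightarrow> (f y, f z) \<in> parcs G" using move[OF x] by blast
    have e: "(u, v) \<in> parcs G" "(v, v') \<in> parcs G" "(v', u') \<in> parcs G" "(u, u') \<in> parcs G"
      using u v adj arcs_symmetric by auto
    have "f u \<noteq> f v'" "f v \<noteq> f u'"
      using f(1) outer e by (auto simp: inj_on_def dest: in_arcsD1 in_arcsD2)
    with f(2) e[THEN f(3)] show ?thesis by blast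
  qed
  have u'u: "(u', u) \<in> parcs G" and v'v: "(v', v) \<in> parcs G"
    and v'u': "(v', u') \<in> parcs G" and w'w: "(w', w) \<in> parcs G"
    using u v w adj arcs_symmetric by auto
  \<comment> \<open>Here \<open>v\<close> and \<open>u'\<close> both have neighbourhood
    \<open>{u, w, v'}\<close>. A triangle at \<open>v'\<close> would use \<open>v\<close> or
    \<open>u'\<close>, hence \<open>u\<close> or \<open>w\<close>, but neither of these is adjacent
    to \<open>v'\<close>.\<close>
  have diamond: False if "w' = u'"
  proof -
    have n: "(u', z) \<in> parcs G \<longleftrightarrow> z = u \<or> z = w \<or> z = v'" for z
      using cubic u'u w'w adj that outer uvw by (intro cubic_neighbours) auto
    obtain t where t: "\<And>z. (v', z) \<in> parcs G \<longleftrightarrow> z = v \<or> z = u' \<or> z = t"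
      using cubic_third_neighbour[OF cubic v'v v'u'] outer by metis
    obtain y z where "(v', y) \<in> parcs G" "(y, z) \<in> parcs G" "(v', z) \<in> parcs G"
      using triangle[of v'] in_arcsD1[OF v'v] by blast
    then show False using n t u v w sym that loop outer uvw by metis
  qed
  \<comment> \<open>The mirror image: \<open>u\<close> and \<open>v'\<close> share the neighbourhood
    \<open>{v, w, u'}\<close>, so no triangle passes through \<open>u'\<close>.\<close>
  have diamond': False if "w' = v'"
  proof -
    have n: "(v', z) \<in> parcs G \<longleftrightarrow> z = v \<or> z = w \<or> z = u'" for z
      using cubic v'v w'w v'u' that outer uvw by (intro cubic_neighbours) auto
    obtain t where t: "\<And>z. (u', z) \<in> parcs G \<longleftrightarrow> z = u \<or> z = v' \<or> z = t"
      using cubic_third_neighbour[OF cubic u'u adj] outer by metis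
    obtain y z where "(u', y) \<in> parcs G" "(y, z) \<in> parcs G" "(u', z) \<in> parcs G"
      using triangle[of u'] in_arcsD1[OF u'u] by blast
    then show False using n t u v w sym that loop outer uvw by metis
  qed
  obtain t where t: "t \<noteq> u" "t \<noteq> v'" "\<And>z. (u', z) \<in> parcs G \<longleftrightarrow> z = u \<or> z = v' \<or> z = t"
    using cubic_third_neighbour[OF cubic u'u adj] outer by metis
  have tu': "(t, u') \<in> parcs G" using t sym by auto
  have not_t: "t \<noteq> v" "t \<noteq> w" "t \<noteq> u'"
    using tu' v w outer uvw diamond loop by metis+
  \<comment> \<open>The triangle at \<open>u'\<close> avoids \<open>u\<close>, whose other
    neighbours \<open>v\<close> and \<open>w\<close> are not adjacent to \<open>u'\<close>; so it is
    formed by \<open>u'\<close>, \<open>v'\<close> and \<open>t\<close>.\<close>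
  have v't: "(v', t) \<in> parcs G"
  proof -
    obtain y z where "(u', y) \<in> parcs G" "(y, z) \<in> parcs G" "(u', z) \<in> parcs G"
      using triangle[of u'] in_arcsD1[OF u'u] by blast
    then show ?thesis using t u sym loop not_t outer uvw by metis
  qed
  have v'n: "(v', z) \<in> parcs G \<longleftrightarrow> z = v \<or> z = u' \<or> z = t" for z
    using cubic v'v v'u' v't not_t outer uvw by (intro cubic_neighbours) auto
  \<comment> \<open>In a 4-cycle \<open>w p q r\<close> the pair \<open>p\<close>, \<open>r\<close>
    is not \<open>u\<close>, \<open>v\<close>, whose only common neighbour is \<open>w\<close>. So
    it contains \<open>w'\<close>, and \<open>q\<close> is adjacent to \<open>w'\<close> and to
    \<open>u\<close> or \<open>v\<close>. This leaves \<open>q\<close> as \<open>u'\<close> or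
    \<open>v'\<close>, whose only possible neighbour \<open>w'\<close> is \<open>t\<close>.\<close>
  have "w' = t"
  proof -
    obtain p q r where "(w, p) \<in> parcs G" "(p, q) \<in> parcs G" "(q, r) \<in> parcs G"
      "(w, r) \<in> parcs G" "w \<noteq> q" "p \<noteq> r"
      using square[of w] in_arcsD2[OF w'w] by blast
    then show ?thesis
      using u v w t(3) v'n sym outer uvw diamond diamond' by metis
  qed
  then have wt: "(t, w) \<in> parcs G" using w'w by simp
  have tn: "(t, z) \<in> parcs G \<longleftrightarrow> z = u' \<or> z = v' \<or> z = w" for z
    using cubic tu' v't wt sym outer uvw by (intro cubic_neighbours) auto
  have wn: "(w, z) \<in> parcs G \<longleftrightarrow> z = u \<or> z = v \<or> z = t" for z
    using w \<open>w' = t\<close> by simp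
  have "{u, t, v, u', w, v'} = pverts G"
  proof (rule connected_closed_eq[OF conn])
    show "{u, t, v, u', w, v'} \<subseteq> pverts G"
      using inV adj tu' v'v wt by (auto dest: in_arcsD1 in_arcsD2)
    show "u \<in> {u, t, v, u', w, v'}" by simp
  next
    fix p q assume "p \<in> {u, t, v, u', w, v'}" and pq: "(p, q) \<in> parcs G"
    then consider "p = u" | "p = t" | "p = v" | "p = u'" | "p = w" | "p = v'" by blast
    then show "q \<in> {u, t, v, u', w, v'}"
      by cases (use pq u v wn t(3) v'n tn in simp_all, blast+)
  qed
  then have V: "pverts G = {u, t, v, u', w, v'}" by simp
  have dist: "distinct [u, t, v, u', w, v']" "distinct [v', w, u', v, t, u]"
    using t(1,2) not_t outer uvw by auto
  \<comment> \<open>In the complement of the cycle \<open>0, \<dots>, 5\<close> the triangles are \<open>024\<close> and \<open>135\<close>,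
    and the matching edges are \<open>03\<close>, \<open>25\<close>, \<open>41\<close>.\<close>
  define g where "g i = [u, t, v, u', w, v'] ! i" for i
  have g: "g 0 = u" "g 1 = t" "g (Suc 0) = t" "g 2 = v" "g 3 = u'" "g 4 = w" "g 5 = v'"
    by (simp_all add: g_def)
  have "bij_betw g (pverts c6_compl) (pverts G)"
    unfolding bij_betw_def pverts_c6_compl V using dist
    by (auto simp: g inj_on_def)
  \<comment> \<open>All 36 pairs are checked against the six neighbourhood equivalences.\<close>
  moreover have "(i, j) \<in> parcs c6_compl \<longleftrightarrow> (g i, g j) \<in> parcs G"
    if "i \<in> pverts c6_compl" "j \<in> pverts c6_compl" for i j
    using that dist unfolding pverts_c6_compl parcs_c6_compl
    by (elim insertE emptyE; simp add: g u v wn t(3) v'n tn)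
  ultimately show ?thesis
    using digraph_iso_with_proj_iff[OF _ pair_wf_digraph_c6_compl, of G] pair_wf_digraph by blast
qed

text \<open>The outer neighbours dominate the triangle and lie off it, so they cannot be
  independent. An edge between two of them is what the preceding lemma needs, up to permuting the
  corners.\<close>

lemma c6_compl_iso_if_strong_triangle:
  assumes conn: "connected (with_proj G)" and cubic: "cubic G" and trans: "vertex_transitive G"
    and strong: "strong_clique G {u, v, w}" and uvw: "u \<noteq> v" "u \<noteq> w" "v \<noteq> w"
  shows "digraph_iso (with_proj G) (with_proj c6_compl)"
proof -
  have loop: "(x, x) \<notin> parcs G" for x using no_loops' by blast
  have e: "(u, v) \<in> parcs G" "(u, w) \<in> parcs G" "(v, u) \<in> parcs G" "(v, w) \<in> parcs G"
    "(w, u) \<in> parcs G" "(w, v) \<in> parcs G"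
    using strong uvw by (auto simp: strong_clique_def clique_def)
  obtain u' where u': "u' \<noteq> v" "u' \<noteq> w" "\<And>z. (u, z) \<in> parcs G \<longleftrightarrow> z = v \<or> z = w \<or> z = u'"
    using cubic_third_neighbour[OF cubic e(1,2)] uvw by metis
  obtain v' where v': "v' \<noteq> u" "v' \<noteq> w" "\<And>z. (v, z) \<in> parcs G \<longleftrightarrow> z = u \<or> z = w \<or> z = v'"
    using cubic_third_neighbour[OF cubic e(3,4)] uvw by metis
  obtain w' where w': "w' \<noteq> u" "w' \<noteq> v" "\<And>z. (w, z) \<in> parcs G \<longleftrightarrow> z = u \<or> z = v \<or> z = w'"
    using cubic_third_neighbour[OF cubic e(5,6)] uvw by metis
  have "\<not> independent_set G {u', v', w'}"
  proof
    assume "independent_set G {u', v', w'}"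
    moreover have "u' \<noteq> u" "v' \<noteq> v" "w' \<noteq> w" using u'(3) v'(3) w'(3) loop by blast+
    then have "{u', v', w'} \<inter> {u, v, w} = {}" using u'(1,2) v'(1,2) w'(1,2) by simp
    ultimately show False using strong u'(3) v'(3) w'(3) unfolding strong_clique_iff by blast
  qed
  moreover have "u' \<in> pverts G" "v' \<in> pverts G" "w' \<in> pverts G"
    using u'(3) v'(3) w'(3) by (auto intro: in_arcsD2)
  ultimately consider "(u', v') \<in> parcs G" | "(u', w') \<in> parcs G" | "(v', w') \<in> parcs G"
    using loop arcs_symmetric unfolding independent_set_def by blast
  then show ?thesis
  proof cases
    case 1
    show ?thesis
      by (rule c6_compl_iso_if_strong_triangle_aux[OF conn cubic trans u'(3) v'(3) w'(3)])
        (use 1 u' v' w' in auto)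
  next
    case 2
    show ?thesis
      by (rule c6_compl_iso_if_strong_triangle_aux[OF conn cubic trans, of u w v u' w' v'])
        (use 2 u' v' w' in auto)
  next
    case 3
    show ?thesis
      by (rule c6_compl_iso_if_strong_triangle_aux[OF conn cubic trans, of v w u v' w' u'])
        (use 3 u' v' w' in auto)
  qed
qed

section \<open>The three graphs are localizable\<close>

text \<open>One part suffices: only the empty set is disjoint from the whole vertex set, and it
  dominates no vertex.\<close>

lemma localizable_complete:
  assumes "K\<^bsub>n\<^esub> (with_proj G)" "pverts G \<noteq> {}"
  shows "localizable G"
proof -
  have "clique G (pverts G)"
    using assms(1) by (auto simp: complete_digraph_pair_def clique_def)
  then have "strong_clique G (pverts G)"
    using assms(2) by (fastforce simp: strong_clique_iff independent_set_def)
  then show ?thesis using assms(2)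
    by (auto simp: localizable_def partition_on_def intro!: exI[of _ "{pverts G}"])
qed

text \<open>The parts are the edges of a perfect matching, given by a bijection \<open>f\<close>
  between the two sides.\<close>

lemma localizable_complete_bipartite:
  assumes "K\<^bsub>n,n\<^esub> (with_proj G)"
  shows "localizable G"
proof -
  obtain A B where V: "pverts G = A \<union> B" "A \<inter> B = {}" and card: "card A = card B"
    and E: "parcs G = A \<times> B \<union> B \<times> A"
    using assms by (auto simp: complete_bipartite_digraph_pair_def)
  have "finite A" "finite B" using V pair_finite_verts by auto
  with card obtain f where f: "bij_betw f A B"
    using finite_same_card_bij by blast
  have fB: "f x \<in> B" if "x \<in> A" for x using f that by (auto simp: bij_betw_def)
  \<comment> \<open>A neighbour of \<open>x\<close> lies in \<open>B\<close> and a neighbour of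
    \<open>f x\<close> in \<open>A\<close>, so the two are adjacent and no independent set contains
    both.\<close>
  have "strong_clique G {x, f x}" if x: "x \<in> A" for x
    unfolding strong_clique_iff
  proof (intro conjI allI impI notI)
    show "clique G {x, f x}" using x fB[OF x] by (auto simp: clique_def E V)
    fix I assume "independent_set G I \<and> I \<inter> {x, f x} = {}"
      and "\<forall>v\<in>{x, f x}. \<exists>w\<in>I. (v, w) \<in> parcs G"
    then obtain y z where "y \<in> I" "z \<in> I" "(x, y) \<in> parcs G" "(f x, z) \<in> parcs G"
      and I: "independent_set G I" by blast
    moreover from this have "(y, z) \<in> parcs G" using x fB[OF x] V by (auto simp: E)
    ultimately show False by (auto simp: independent_set_def)
  qed
  moreover have "partition_on (pverts G) ((\<lambda>x. {x, f x}) ` A)"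
  proof (rule partition_onI)
    show "\<Union> ((\<lambda>x. {x, f x}) ` A) = pverts G"
      using f by (auto simp: V bij_betw_def)
  next
    fix p q assume "p \<in> (\<lambda>x. {x, f x}) ` A" "q \<in> (\<lambda>x. {x, f x}) ` A" "p \<noteq> q"
    then obtain x y where "x \<in> A" "y \<in> A" "p = {x, f x}" "q = {y, f y}" "x \<noteq> y" by auto
    moreover from this have "f x \<noteq> f y" using f by (auto simp: bij_betw_def dest: inj_onD)
    ultimately show "disjnt p q" using fB[of x] fB[of y] V(2) by (auto simp: disjnt_def)
  qed auto
  ultimately show ?thesis by (auto simp: localizable_def)
qed

text \<open>The parts are the two triangles of the prism. Each is strong because two of its outer
  neighbours are adjacent.\<close>

lemma localizable_c6_compl:
  assumes "digraph_iso (with_proj G) (with_proj c6_compl)"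
  shows "localizable G"
proof -
  obtain g where bij: "bij_betw g (pverts c6_compl) (pverts G)"
    and E: "\<And>i j. i \<in> pverts c6_compl \<Longrightarrow> j \<in> pverts c6_compl \<Longrightarrow>
      (g i, g j) \<in> parcs G \<longleftrightarrow> (i, j) \<in> parcs c6_compl"
    using digraph_iso_with_proj_iff[OF _ pair_wf_digraph_c6_compl, of G] pair_wf_digraph assms
    by blast
  have V: "pverts G = g ` {0, 1, 2, 3, 4, 5}"
    using bij by (auto simp: bij_betw_def pverts_c6_compl)
  note E = E[unfolded pverts_c6_compl]
  \<comment> \<open>Here \<open>l\<close> and \<open>m\<close> stand for the outer neighbours of
    \<open>i\<close> and \<open>j\<close>. A dominating set disjoint from the triangle must contain
    the images of both, and these are adjacent.\<close>
  have strong: "strong_clique G (g ` {i, j, k})"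
    if ijk: "i \<in> {0, 1, 2, 3, 4, 5}" "j \<in> {0, 1, 2, 3, 4, 5}" "k \<in> {0, 1, 2, 3, 4, 5}"
      "(i, j) \<in> parcs c6_compl" "(i, k) \<in> parcs c6_compl" "(j, k) \<in> parcs c6_compl"
      and l: "\<And>z. (i, z) \<in> parcs c6_compl \<Longrightarrow> z = j \<or> z = k \<or> z = l"
      and m: "\<And>z. (j, z) \<in> parcs c6_compl \<Longrightarrow> z = i \<or> z = k \<or> z = m"
      and lm: "(l, m) \<in> parcs c6_compl" "l \<in> {0, 1, 2, 3, 4, 5}" "m \<in> {0, 1, 2, 3, 4, 5}"
    for i j k l m
    unfolding strong_clique_iff
  proof (intro conjI allI impI notI)
    have "(g i, g j) \<in> parcs G" "(g i, g k) \<in> parcs G" "(g j, g k) \<in> parcs G"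
      using ijk E by blast+
    moreover from this[THEN arcs_symmetric]
    have "(g j, g i) \<in> parcs G" "(g k, g i) \<in> parcs G" "(g k, g j) \<in> parcs G" .
    moreover have "g ` {i, j, k} \<subseteq> pverts G" unfolding V using ijk(1-3) by blast
    ultimately show "clique G (g ` {i, j, k})" by (simp add: clique_def)
    fix I assume I: "independent_set G I \<and> I \<inter> g ` {i, j, k} = {}"
      and dom: "\<forall>v\<in>g ` {i, j, k}. \<exists>w\<in>I. (v, w) \<in> parcs G"
    then have IV: "I \<subseteq> g ` {0, 1, 2, 3, 4, 5}" by (simp add: independent_set_def V)
    obtain p where "g p \<in> I" "(g i, g p) \<in> parcs G" "p \<in> {0, 1, 2, 3, 4, 5}"
      using dom IV by blast
    then have "g l \<in> I" using l[of p] E[OF ijk(1), of p] I by auto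
    obtain q where "g q \<in> I" "(g j, g q) \<in> parcs G" "q \<in> {0, 1, 2, 3, 4, 5}"
      using dom IV by blast
    then have "g m \<in> I" using m[of q] E[OF ijk(2), of q] I by auto
    with \<open>g l \<in> I\<close> I E[OF lm(2,3)] lm(1) show False by (auto simp: independent_set_def)
  qed
  \<comment> \<open>The outer neighbours of 0 and 2 are 3 and 5; those of 1 and 3 are 4 and
    0.\<close>
  have "strong_clique G (g ` {0, 2, 4})"
    by (rule strong[of 0 2 4 3 5]) (auto simp: parcs_c6_compl)
  moreover have "strong_clique G (g ` {1, 3, 5})"
    by (rule strong[of 1 3 5 4 0]) (auto simp: parcs_c6_compl)
  moreover have "partition_on (pverts G) {g ` {0, 2, 4}, g ` {1, 3, 5}}"
  proof (rule partition_onI)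
    have "inj_on g {0, 1, 2, 3, 4, 5}" using bij by (simp add: bij_betw_def pverts_c6_compl)
    then have "g ` {0, 2, 4} \<inter> g ` {1, 3, 5} = {}" by (auto simp: inj_on_def)
    then show "disjnt p q" if "p \<in> {g ` {0, 2, 4}, g ` {1, 3, 5}}"
      "q \<in> {g ` {0, 2, 4}, g ` {1, 3, 5}}" "p \<noteq> q" for p q
      using that unfolding disjnt_def by blast
  qed (auto simp: V)
  ultimately show ?thesis unfolding localizable_def by blast
qed

section \<open>Combining the three possible clique sizes\<close>

lemma strong_clique_cases:
  assumes "connected (with_proj G)" "cubic G" "vertex_transitive G" "strong_clique G C"
    and "pverts G \<noteq> {}"
  shows "K\<^bsub>4\<^esub> (with_proj G) \<or> K\<^bsub>3,3\<^esub> (with_proj G) \<or>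
    digraph_iso (with_proj G) (with_proj c6_compl)"
proof -
  consider "card C = 2" | "card C = 3" | "card C = 4"
    using strong_clique_card[OF assms(2,5,4)] by auto
  then show ?thesis
  proof cases
    case 1
    then obtain u v where "C = {u, v}" "u \<noteq> v" by (auto simp: card_2_iff)
    then show ?thesis using assms complete_bipartite_if_strong_edge by blast
  next
    case 2
    then obtain u v w where "C = {u, v, w}" "u \<noteq> v" "u \<noteq> w" "v \<noteq> w" by (auto simp: card_3_iff)
    then show ?thesis using assms c6_compl_iso_if_strong_triangle by blast
  next
    case 3
    then show ?thesis
      using assms complete_if_clique_card_4 by (auto simp: strong_clique_def)
  qed
qed

end

theorem theorem5p1:
  fixes \<Gamma> :: "'a pair_pre_digraph"
  assumes "pair_graph \<Gamma>"
    and "connected (with_proj \<Gamma>)"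
    and "cubic \<Gamma>"
    and "vertex_transitive \<Gamma>"
  shows "((\<exists>C. strong_clique \<Gamma> C) \<longleftrightarrow> localizable \<Gamma>) \<and>
    (localizable \<Gamma> \<longleftrightarrow>
      K\<^bsub>4\<^esub> (with_proj \<Gamma>) \<or> K\<^bsub>3,3\<^esub> (with_proj \<Gamma>) \<or>
      digraph_iso (with_proj \<Gamma>) (with_proj (complement_graph (cycle_graph 6))))"
proof -
  interpret pair_graph \<Gamma> by fact
  \<comment> \<open>Connectedness includes having a vertex; hence a partition into strong cliques
    has at least one part.\<close>
  have ne: "pverts \<Gamma> \<noteq> {}"
    using assms(2) by (simp add: connected_def strongly_connected_def mk_symmetric_def)
  have "\<exists>C. strong_clique \<Gamma> C" if "localizable \<Gamma>"
    using that ne by (fastforce simp: localizable_def partition_on_def)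
  moreover have "localizable \<Gamma>" if "K\<^bsub>4\<^esub> (with_proj \<Gamma>) \<or> K\<^bsub>3,3\<^esub> (with_proj \<Gamma>) \<or>
      digraph_iso (with_proj \<Gamma>) (with_proj c6_compl)"
    using that ne localizable_complete localizable_complete_bipartite localizable_c6_compl by blast
  ultimately show ?thesis
    using strong_clique_cases[OF assms(2-4) _ ne] by blast
qed

end
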